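(* For every $v\le c$ and every $k_0\in\{0,\dots,\kappa-1\}$, $$\mathrm{OPT}^{(k_0)}_v\Big(\bigcup_{k=0}^{k_0+1}\tilde I_k\ \cup\bigcup_{k=k_0+2}^{\kappa}I_k\Big)\ \ge\ \left(1-\frac{\varepsilon}{4}\cdot\frac{1}{\log_2(2/\varepsilon)+1}\right)^{k_0+1}\mathrm{OPT}_v(I_L^{red}).$$
   Context: UKP instance $I$: items with profits $p(a)\in(0,1]$, sizes $s(a)\in(0,1]$, capacity $c=1$. For a set $I'$ of items and $0\le v\le c$, $\mathrm{OPT}_v(I')=\max\{\sum_{a\in I'}p(a)x_a:\sum_{a\in I'}s(a)x_a\le v,\ x_a\in\mathbb{N}\}$. Let $\varepsilon=1/2^{\kappa-1}$, $\kappa\in\mathbb{N}$, $\varepsilon\le1/4$. Let $a_{me}$ maximize $p/s$ over $I$, $P_0=p(a_{me})\lfloor c/s(a_{me})\rfloor$, $T=\frac12\varepsilon P_0$, $K=\frac14\cdot\frac1{\kappa+1}\varepsilon T$, $I_L=\{a\in I:p(a)\ge T\}$. Standing assumption: $I$ contains no item of profit $2P_0$. For $k\in\{0,\dots,\kappa\}$ let $L_k=[2^kT,2^{k+1}T)$ and for $\gamma\in\{0,\dots,2^{\kappa+1}(\kappa+1)-1\}$ let $L_{k,\gamma}=[2^kT+\gamma2^kK,\ 2^kT+(\gamma+1)2^kK)$. Let $a_{k,\gamma}$ be an item of minimum size among items of $I_L$ with profit in $L_{k,\gamma}$ (if any), $I_L^{red}$ the set of all existing $a_{k,\gamma}$,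 and $I_k=\{a\in I_L^{red}:p(a)\in L_k\}$. Gluing: for items $a_1,a_2$ with $s(a_1)+s(a_2)\le c$, $a_1\oplus a_2$ is a new item with profit $p(a_1)+p(a_2)$ and size $s(a_1)+s(a_2)$; glued items are treated as ordinary items. Define $\tilde I_0=I_0$ and, for $k=0,\dots,\kappa-1$ and each $\gamma$, let $\tilde a_{k+1,\gamma}$ be an item of minimum size among the items of $I_{k+1}\cup\{\tilde a\oplus\tilde a':\tilde a,\tilde a'\in\tilde I_k \text{ (possibly equal)},\ s(\tilde a)+s(\tilde a')\le c\}$ whose profit lies in $L_{k+1,\gamma}$ (if any), and $\tilde I_{k+1}$ the set of all existing $\tilde a_{k+1,\gamma}$. Structured optimum: for a set $I'$ of items each of profit at least $T$, $v\le c$ and $k_0\in\{0,\dots,\kappa\}$, $\mathrm{OPT}^{(k_0)}_v(I')$ is the maximum profit of a multiset of items of $I'$ of total size at most $v$ that contains, for each $k\in\{0,\dots,k_0\}$, at most one item copy with profit in $L_k$. *)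

theory Defs
  imports Complex_Main "HOL-Library.Multiset" "HOL-Library.FuncSet"
begin

abbreviation (input) capacity :: real where
  "capacity \<equiv> 1"

definition ukp_instance :: "'a set \<Rightarrow> ('a \<Rightarrow> real) \<Rightarrow> ('a \<Rightarrow> real) \<Rightarrow> bool" where
  "ukp_instance I p s \<longleftrightarrow>
     finite I \<and> I \<noteq> {} \<and> (\<forall>a\<in>I. 0 < p a \<and> p a \<le> 1 \<and> 0 < s a \<and> s a \<le> 1)"

text \<open>The maximum is over a finite nonempty set of values whenever the item set is finite, all
  sizes are positive and the size bound is nonnegative; see the two facts at the end.\<close>

definition opt_values :: "('a \<Rightarrow> real) \<Rightarrow> ('a \<Rightarrow> real) \<Rightarrow> 'a set \<Rightarrow> real \<Rightarrow> real set" where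
  "opt_values p s A v =
     {(\<Sum>a\<in>A. p a * real (x a)) | x :: 'a \<Rightarrow> nat. (\<Sum>a\<in>A. s a * real (x a)) \<le> v}"

definition opt :: "('a \<Rightarrow> real) \<Rightarrow> ('a \<Rightarrow> real) \<Rightarrow> 'a set \<Rightarrow> real \<Rightarrow> real" where
  "opt p s A v = Max (opt_values p s A v)"

definition L :: "real \<Rightarrow> nat \<Rightarrow> real set" where
  "L T k = {2 ^ k * T ..< 2 ^ (k + 1) * T}"

definition L_sub :: "real \<Rightarrow> real \<Rightarrow> nat \<Rightarrow> nat \<Rightarrow> real set" where
  "L_sub T K k \<gamma> =
     {2 ^ k * T + real \<gamma> * 2 ^ k * K ..< 2 ^ k * T + (real \<gamma> + 1) * 2 ^ k * K}"

definition sub_indices :: "nat \<Rightarrow> nat set" where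
  "sub_indices \<kappa> = {0 ..< 2 ^ (\<kappa> + 1) * (\<kappa> + 1)}"

definition struct_opt_values ::
    "('a \<Rightarrow> real) \<Rightarrow> ('a \<Rightarrow> real) \<Rightarrow> real \<Rightarrow> nat \<Rightarrow> 'a set \<Rightarrow> real \<Rightarrow> real set" where
  "struct_opt_values p s T k\<^sub>0 A v =
     {(\<Sum>a\<in>#M. p a) | M :: 'a multiset.
        set_mset M \<subseteq> A \<and> (\<Sum>a\<in>#M. s a) \<le> v \<and>
        (\<forall>k\<in>{0..k\<^sub>0}. size (filter_mset (\<lambda>a. p a \<in> L T k) M) \<le> 1)}"

definition struct_opt ::
    "('a \<Rightarrow> real) \<Rightarrow> ('a \<Rightarrow> real) \<Rightarrow> real \<Rightarrow> nat \<Rightarrow> 'a set \<Rightarrow> real \<Rightarrow> real" where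
  "struct_opt p s T k\<^sub>0 A v = Max (struct_opt_values p s T k\<^sub>0 A v)"

definition large_items :: "'a set \<Rightarrow> ('a \<Rightarrow> real) \<Rightarrow> real \<Rightarrow> 'a set" where
  "large_items I p T = {a \<in> I. p a \<ge> T}"

definition large_items_sub ::
    "'a set \<Rightarrow> ('a \<Rightarrow> real) \<Rightarrow> real \<Rightarrow> real \<Rightarrow> nat \<Rightarrow> nat \<Rightarrow> 'a set" where
  "large_items_sub I p T K k \<gamma> = {a \<in> large_items I p T. p a \<in> L_sub T K k \<gamma>}"

text \<open>Ties between items of minimum size are broken arbitrarily: the family \<open>r\<close> is any
  selection of minimum-size items, and \<open>r k \<gamma>\<close> is unconstrained (and unused) if there is no
  item to select.\<close>

definition reduction_choice ::
    "'a set \<Rightarrow> ('a \<Rightarrow> real) \<Rightarrow> ('a \<Rightarrow> real) \<Rightarrow> real \<Rightarrow> real \<Rightarrow> nat \<Rightarrow> (nat \<Rightarrow> nat \<Rightarrow> 'a) \<Rightarrow> bool" where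
  "reduction_choice I p s T K \<kappa> r \<longleftrightarrow>
     (\<forall>k\<in>{0..\<kappa>}. \<forall>\<gamma>\<in>sub_indices \<kappa>. large_items_sub I p T K k \<gamma> \<noteq> {} \<longrightarrow>
        is_arg_min s (\<lambda>a. a \<in> large_items_sub I p T K k \<gamma>) (r k \<gamma>))"

definition reduced_items ::
    "'a set \<Rightarrow> ('a \<Rightarrow> real) \<Rightarrow> real \<Rightarrow> real \<Rightarrow> nat \<Rightarrow> (nat \<Rightarrow> nat \<Rightarrow> 'a) \<Rightarrow> 'a set" where
  "reduced_items I p T K \<kappa> r =
     {r k \<gamma> | k \<gamma>. k \<in> {0..\<kappa>} \<and> \<gamma> \<in> sub_indices \<kappa> \<and> large_items_sub I p T K k \<gamma> \<noteq> {}}"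

definition reduced_level ::
    "'a set \<Rightarrow> ('a \<Rightarrow> real) \<Rightarrow> real \<Rightarrow> real \<Rightarrow> nat \<Rightarrow> (nat \<Rightarrow> nat \<Rightarrow> 'a) \<Rightarrow> nat \<Rightarrow> 'a set" where
  "reduced_level I p T K \<kappa> r k = {a \<in> reduced_items I p T K \<kappa> r. p a \<in> L T k}"

text \<open>Items of the instance together with all formal gluings of them. \<open>Glue\<close> is total; the
  condition that the two sizes fit into the capacity is imposed where gluings are formed.\<close>

datatype 'a glued = Orig 'a | Glue "'a glued" "'a glued" (infixl \<open>\<oplus>\<close> 65)

text \<open>Additive extension of a profit or size function to glued items.\<close>

primrec ext :: "('a \<Rightarrow> real) \<Rightarrow> 'a glued \<Rightarrow> real" where
  "ext f (Orig a) = f a"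
| "ext f (a\<^sub>1 \<oplus> a\<^sub>2) = ext f a\<^sub>1 + ext f a\<^sub>2"

text \<open>The items with profit in \<open>L_sub T K (k + 1) \<gamma>\<close> that compete at level \<open>k + 1\<close>, where
  \<open>J\<close> stands for the set of glued items at level \<open>k\<close>.\<close>

definition glue_candidates ::
    "'a set \<Rightarrow> ('a \<Rightarrow> real) \<Rightarrow> ('a \<Rightarrow> real) \<Rightarrow> real \<Rightarrow> real \<Rightarrow> nat \<Rightarrow> (nat \<Rightarrow> nat \<Rightarrow> 'a)
      \<Rightarrow> 'a glued set \<Rightarrow> nat \<Rightarrow> nat \<Rightarrow> 'a glued set" where
  "glue_candidates I p s T K \<kappa> r J k \<gamma> =
     {b \<in> Orig ` reduced_level I p T K \<kappa> r (k + 1) \<union>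
          {a \<oplus> a' | a a'. a \<in> J \<and> a' \<in> J \<and> ext s a + ext s a' \<le> capacity}.
        ext p b \<in> L_sub T K (k + 1) \<gamma>}"

text \<open>The family \<open>g\<close> selects the items of positive level, as \<open>r\<close> does for the reduced items.\<close>

primrec glued_level ::
    "'a set \<Rightarrow> ('a \<Rightarrow> real) \<Rightarrow> ('a \<Rightarrow> real) \<Rightarrow> real \<Rightarrow> real \<Rightarrow> nat \<Rightarrow> (nat \<Rightarrow> nat \<Rightarrow> 'a)
      \<Rightarrow> (nat \<Rightarrow> nat \<Rightarrow> 'a glued) \<Rightarrow> nat \<Rightarrow> 'a glued set" where
  "glued_level I p s T K \<kappa> r g 0 = Orig ` reduced_level I p T K \<kappa> r 0"
| "glued_level I p s T K \<kappa> r g (Suc k) =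
     {g (k + 1) \<gamma> | \<gamma>. \<gamma> \<in> sub_indices \<kappa> \<and>
        glue_candidates I p s T K \<kappa> r (glued_level I p s T K \<kappa> r g k) k \<gamma> \<noteq> {}}"

definition glue_choice ::
    "'a set \<Rightarrow> ('a \<Rightarrow> real) \<Rightarrow> ('a \<Rightarrow> real) \<Rightarrow> real \<Rightarrow> real \<Rightarrow> nat \<Rightarrow> (nat \<Rightarrow> nat \<Rightarrow> 'a)
      \<Rightarrow> (nat \<Rightarrow> nat \<Rightarrow> 'a glued) \<Rightarrow> bool" where
  "glue_choice I p s T K \<kappa> r g \<longleftrightarrow>
     (\<forall>k\<in>{0..<\<kappa>}. \<forall>\<gamma>\<in>sub_indices \<kappa>.
        let C = glue_candidates I p s T K \<kappa> r (glued_level I p s T K \<kappa> r g k) k \<gamma>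
        in C \<noteq> {} \<longrightarrow> is_arg_min (ext s) (\<lambda>b. b \<in> C) (g (k + 1) \<gamma>))"

lemma opt_values_finite_nonempty:
  assumes "finite A" "\<And>a. a \<in> A \<Longrightarrow> 0 < s a" "0 \<le> v"
  shows "finite (opt_values p s A v)" "opt_values p s A v \<noteq> {}"
proof -
  define B where "B a = {..nat \<lfloor>v / s a\<rfloor>}" for a
  have "opt_values p s A v \<subseteq> (\<lambda>x. \<Sum>a\<in>A. p a * real (x a)) ` PiE A B"
  proof
    fix y assume "y \<in> opt_values p s A v"
    then obtain x where y: "y = (\<Sum>a\<in>A. p a * real (x a))"
      and x: "(\<Sum>a\<in>A. s a * real (x a)) \<le> v"
      unfolding opt_values_def by blast
    have "x a \<in> B a" if a: "a \<in> A" for a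
    proof -
      have "s a * real (x a) \<le> (\<Sum>a\<in>A. s a * real (x a))"
        using a assms by (intro member_le_sum) (auto simp: less_imp_le)
      then have "real (x a) \<le> v / s a"
        using x assms(2)[OF a] by (simp add: pos_le_divide_eq mult.commute)
      then show ?thesis unfolding B_def atMost_iff by (rule le_nat_floor)
    qed
    then have "restrict x A \<in> PiE A B" by (simp add: restrict_PiE_iff)
    moreover have "y = (\<Sum>a\<in>A. p a * real (restrict x A a))"
      unfolding y by (intro sum.cong) auto
    ultimately show "y \<in> (\<lambda>x. \<Sum>a\<in>A. p a * real (x a)) ` PiE A B" by (intro image_eqI)
  qed
  moreover have "finite (PiE A B)"
    using assms(1) by (intro finite_PiE) (auto simp: B_def)
  ultimately show "finite (opt_values p s A v)" by (rule finite_subset[OF _ finite_imageI])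
  have "(\<Sum>a\<in>A. p a * real ((\<lambda>_. 0) a)) \<in> opt_values p s A v"
    unfolding opt_values_def by (intro CollectI exI[of _ "\<lambda>_. 0"]) (simp add: assms(3))
  then show "opt_values p s A v \<noteq> {}" by auto
qed

lemma struct_opt_values_finite_nonempty:
  assumes "finite A" "\<And>a. a \<in> A \<Longrightarrow> 0 < s a" "0 \<le> v"
  shows "finite (struct_opt_values p s T k\<^sub>0 A v)" "struct_opt_values p s T k\<^sub>0 A v \<noteq> {}"
proof -
  define m where "m = Min (insert 1 (s ` A))"
  have m0: "0 < m" using assms unfolding m_def by (subst Min_gr_iff) auto
  have ms: "m \<le> s a" if "a \<in> A" for a
    using assms(1) that unfolding m_def by (intro Min_le) auto
  define N where "N = nat \<lfloor>v / m\<rfloor>"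
  have "struct_opt_values p s T k\<^sub>0 A v \<subseteq>
      (\<lambda>xs. \<Sum>a\<in>#mset xs. p a) ` {xs. set xs \<subseteq> A \<and> length xs \<le> N}"
  proof
    fix y assume "y \<in> struct_opt_values p s T k\<^sub>0 A v"
    then obtain M where y: "y = (\<Sum>a\<in>#M. p a)"
      and M: "set_mset M \<subseteq> A" "(\<Sum>a\<in>#M. s a) \<le> v"
      unfolding struct_opt_values_def by blast
    obtain xs where xs: "M = mset xs" by (use ex_mset[of M] in auto)
    have "real (size M) * m \<le> (\<Sum>a\<in>#M. s a)"
      using M(1)
    proof (induction M)
      case empty
      then show ?case by simp
    next
      case (add x M)
      then show ?case using ms[of x] by (simp add: algebra_simps)
    qed
    then have "real (size M) \<le> v / m" using M(2) m0 by (simp add: pos_le_divide_eq)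
    then have "size M \<le> N" unfolding N_def by (rule le_nat_floor)
    then have "xs \<in> {xs. set xs \<subseteq> A \<and> length xs \<le> N}" using xs M(1) by simp
    then show "y \<in> (\<lambda>xs. \<Sum>a\<in>#mset xs. p a) ` {xs. set xs \<subseteq> A \<and> length xs \<le> N}"
      unfolding y xs by (rule imageI)
  qed
  then show "finite (struct_opt_values p s T k\<^sub>0 A v)"
    by (rule finite_subset[OF _ finite_imageI[OF finite_lists_length_le[OF assms(1)]]])
  have "(\<Sum>a\<in>#{#}. p a) \<in> struct_opt_values p s T k\<^sub>0 A v"
    unfolding struct_opt_values_def by (intro CollectI exI[of _ "{#}"]) (simp add: assms(3))
  then show "struct_opt_values p s T k\<^sub>0 A v \<noteq> {}" by auto
qed

end

theory Submission
  imports Defs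
begin

text \<open>Start from an optimal multiset of reduced items and treat the levels one after the other.
  At level \<open>j\<close>, pair up all but at most one of the items with profit in \<open>L\<^sub>j\<close>; every pair has
  total size at most the capacity and, glued, a profit in \<open>L\<^sub>j\<^sub>+\<^sub>1\<close>. Replacing these pairs and the
  original items of \<open>L\<^sub>j\<^sub>+\<^sub>1\<close> by the smallest item of their subinterval does not increase the
  size. As the subintervals of \<open>L\<^sub>j\<^sub>+\<^sub>1\<close> have width \<open>2\<^sup>j\<^sup>+\<^sup>1 K = \<delta> 2\<^sup>j\<^sup>+\<^sup>1 T\<close>, with
  \<open>\<delta> = \<epsilon> / (4 (\<kappa> + 1))\<close>, it costs at most a factor \<open>1 - \<delta>\<close> in profit.\<close>

section \<open>Dyadic profit intervals\<close>

lemma L_disjoint: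
  assumes "0 < T" "x \<in> L T k" "x \<in> L T l"
  shows "k = l"
proof -
  have "\<not> m < n" if "x \<in> L T m" "x \<in> L T n" for m n
  proof
    assume "m < n"
    then have "(2::real) ^ (m + 1) * T \<le> 2 ^ n * T"
      using assms(1) by (intro mult_right_mono power_increasing) auto
    then show False using that by (simp add: L_def)
  qed
  then show ?thesis using assms(2,3) by (meson nat_neq_iff)
qed

lemma add_in_L_Suc:
  assumes "x \<in> L T k" "y \<in> L T k"
  shows "x + y \<in> L T (Suc k)"
  using assms by (auto simp: L_def)

section \<open>Replacing the elements of a multiset\<close>

lemma sum_mset_image_nonneg:
  fixes f :: "'b \<Rightarrow> real"
  assumes "\<And>x. x \<in># M \<Longrightarrow> 0 \<le> f x"
  shows "0 \<le> (\<Sum>x\<in>#M. f x)"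
  using assms by (induction M) auto

text \<open>Induction on the size, removing two elements at a time; \<open>R\<close> holds the
  element left over when the size is odd. Any two elements of \<open>N\<close> have total size at
  most \<open>c\<close>, because the other sizes are nonnegative, so \<open>glue\<close> always
  applies.\<close>

lemma pairing:
  fixes p s :: "'b \<Rightarrow> real"
  assumes glue: "\<And>a a'. a \<in> J \<Longrightarrow> a' \<in> J \<Longrightarrow> s a + s a' \<le> c \<Longrightarrow>
      \<exists>b\<in>B. s b \<le> s a + s a' \<and> q * (p a + p a') \<le> p b"
    and nonneg: "\<And>a. a \<in> J \<Longrightarrow> 0 \<le> p a \<and> 0 \<le> s a"
    and q: "q \<le> 1"
    and N: "set_mset N \<subseteq> J" "(\<Sum>a\<in>#N. s a) \<le> c"
  shows "\<exists>R N'. set_mset R \<subseteq> J \<and> size R \<le> 1 \<and> set_mset N' \<subseteq> B \<and>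
      (\<Sum>a\<in>#R + N'. s a) \<le> (\<Sum>a\<in>#N. s a) \<and>
      q * (\<Sum>a\<in>#N. p a) \<le> (\<Sum>a\<in>#R + N'. p a)"
  using N
proof (induction N rule: measure_induct_rule[of size])
  case (less N)
  show ?case
  proof (cases "size N \<le> 1")
    case True
    have "0 \<le> (\<Sum>a\<in>#N. p a)" using less.prems(1) nonneg by (intro sum_mset_image_nonneg) auto
    then have "q * (\<Sum>a\<in>#N. p a) \<le> (\<Sum>a\<in>#N. p a)"
      using mult_right_mono[OF q] by simp
    then show ?thesis
      using True less.prems by (intro exI[of _ N] exI[of _ "{#}"]) auto
  next
    case False
    then obtain a N1 where N1: "N = add_mset a N1"
      by (cases N) auto
    with False obtain a' N0 where "N1 = add_mset a' N0"
      by (cases N1) auto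
    with N1 have N0: "N = add_mset a (add_mset a' N0)" by simp
    have "0 \<le> (\<Sum>a\<in>#N0. s a)"
      using less.prems(1) nonneg N0 by (intro sum_mset_image_nonneg) auto
    moreover have J: "a \<in> J" "a' \<in> J" using less.prems(1) N0 by auto
    ultimately obtain b where b: "b \<in> B" "s b \<le> s a + s a'" "q * (p a + p a') \<le> p b"
      using glue[OF J] less.prems(2) N0 by auto
    have "(\<Sum>a\<in>#N0. s a) \<le> c"
      using less.prems(2) N0 nonneg[OF J(1)] nonneg[OF J(2)] by simp
    with less.IH[of N0] less.prems(1) N0 obtain R N' where IH:
      "set_mset R \<subseteq> J" "size R \<le> 1" "set_mset N' \<subseteq> B"
      "(\<Sum>a\<in>#R + N'. s a) \<le> (\<Sum>a\<in>#N0. s a)"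
      "q * (\<Sum>a\<in>#N0. p a) \<le> (\<Sum>a\<in>#R + N'. p a)"
      by auto
    then show ?thesis
      using b N0 by (intro exI[of _ R] exI[of _ "add_mset b N'"]) (auto simp: algebra_simps)
  qed
qed

text \<open>The counterpart of \<open>pairing\<close> for items that are rounded one at a time; it
  serves the original items that already lie in the next level.\<close>

lemma itemwise_replacement:
  fixes p s :: "'b \<Rightarrow> real"
  assumes "\<And>a. a \<in># N \<Longrightarrow> \<exists>b\<in>B. s b \<le> s a \<and> q * p a \<le> p b"
  shows "\<exists>N'. set_mset N' \<subseteq> B \<and> (\<Sum>a\<in>#N'. s a) \<le> (\<Sum>a\<in>#N. s a) \<and>
      q * (\<Sum>a\<in>#N. p a) \<le> (\<Sum>a\<in>#N'. p a)"
  using assms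
proof (induction N)
  case empty
  then show ?case by (intro exI[of _ "{#}"]) auto
next
  case (add a N)
  then obtain N' where "set_mset N' \<subseteq> B" "(\<Sum>a\<in>#N'. s a) \<le> (\<Sum>a\<in>#N. s a)"
      "q * (\<Sum>a\<in>#N. p a) \<le> (\<Sum>a\<in>#N'. p a)"
    by auto
  moreover obtain b where "b \<in> B" "s b \<le> s a" "q * p a \<le> p b"
    using add.prems[of a] by auto
  ultimately show ?case
    by (intro exI[of _ "add_mset b N'"]) (auto simp: algebra_simps)
qed

section \<open>Subintervals of a level\<close>

text \<open>\<delta> is the width of a subinterval relative to the left endpoint of its level.
  \<open>K_total\<close> says that the subintervals with index in
  \<open>sub_indices \<kappa>\<close> exactly fill the level.\<close>

locale gluing =
  fixes I :: "'a set" and p s :: "'a \<Rightarrow> real" and T K \<delta> :: real and \<kappa> :: nat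
    and r :: "nat \<Rightarrow> nat \<Rightarrow> 'a" and g :: "nat \<Rightarrow> nat \<Rightarrow> 'a glued"
  assumes item_pos: "\<And>a. a \<in> I \<Longrightarrow> 0 < p a \<and> 0 < s a"
    and T_pos: "0 < T"
    and K_eq: "K = \<delta> * T"
    and \<delta>_bounds: "0 < \<delta>" "\<delta> \<le> 1"
    and K_total: "2 ^ (\<kappa> + 1) * (real \<kappa> + 1) * K = T"
    and r: "reduction_choice I p s T K \<kappa> r"
    and g: "glue_choice I p s T K \<kappa> r g"
begin

abbreviation "I_red \<equiv> reduced_items I p T K \<kappa> r"
abbreviation "I_lev \<equiv> reduced_level I p T K \<kappa> r"
abbreviation "I_glued \<equiv> glued_level I p s T K \<kappa> r g"
abbreviation "cands k \<equiv> glue_candidates I p s T K \<kappa> r (I_glued k) k"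

lemma K_pos: "0 < K"
  using K_eq T_pos \<delta>_bounds by simp

text \<open>By \<open>K_total\<close>, the last subinterval ends where the level ends.\<close>

lemma L_sub_subset_L:
  assumes "\<gamma> \<in> sub_indices \<kappa>"
  shows "L_sub T K k \<gamma> \<subseteq> L T k"
proof -
  have "\<gamma> + 1 \<le> 2 ^ (\<kappa> + 1) * (\<kappa> + 1)" using assms by (simp add: sub_indices_def)
  then have "real (\<gamma> + 1) \<le> real (2 ^ (\<kappa> + 1) * (\<kappa> + 1))" by (rule of_nat_mono)
  then have "(real \<gamma> + 1) * K \<le> 2 ^ (\<kappa> + 1) * (real \<kappa> + 1) * K"
    using K_pos by (intro mult_right_mono) (auto simp: algebra_simps)
  then have "2 ^ k * ((real \<gamma> + 1) * K) \<le> 2 ^ k * T"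
    unfolding K_total by (intro mult_left_mono) auto
  moreover have "0 \<le> real \<gamma> * 2 ^ k * K" using K_pos by simp
  ultimately show ?thesis by (auto simp: L_def L_sub_def algebra_simps)
qed

lemma L_sub_cover:
  assumes "x \<in> L T k"
  obtains \<gamma> where "\<gamma> \<in> sub_indices \<kappa>" "x \<in> L_sub T K k \<gamma>"
proof -
  define w where "w = 2 ^ k * K"
  have w: "0 < w" using K_pos by (simp add: w_def)
  \<comment> \<open>The offset of \<open>x\<close> in the level, measured in subinterval widths; its
    integer part is the index sought.\<close>
  define y where "y = (x - 2 ^ k * T) / w"
  define n where "n = nat \<lfloor>y\<rfloor>"
  have x: "x = 2 ^ k * T + y * w" using w by (simp add: y_def)
  have "0 \<le> y" using assms w by (simp add: y_def L_def)
  then have n: "real n \<le> y" "y < real n + 1" unfolding n_def by linarith+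
  have "x < 2 * (2 ^ k * T)" using assms by (simp add: L_def mult.assoc)
  then have "y * w < 2 ^ k * T" using x by linarith
  also have "\<dots> = real (2 ^ (\<kappa> + 1) * (\<kappa> + 1)) * w"
    by (subst K_total[symmetric]) (simp add: w_def algebra_simps)
  finally have "y < real (2 ^ (\<kappa> + 1) * (\<kappa> + 1))"
    using w mult_less_cancel_right_pos by blast
  with n(1) have "real n < real (2 ^ (\<kappa> + 1) * (\<kappa> + 1))" by linarith
  then have "n \<in> sub_indices \<kappa>" unfolding of_nat_less_iff by (simp add: sub_indices_def)
  moreover have "x \<in> L_sub T K k n"
    using mult_right_mono[OF n(1), of w] mult_strict_right_mono[OF n(2) w] w
    by (simp add: L_sub_def x w_def algebra_simps)
  ultimately show thesis by (rule that)
qed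

text \<open>The width \<open>2 ^ k * K\<close> is \<delta> times the left endpoint of the level,
  hence at most \<delta> times \<open>x\<close>. This is the source of the factor
  \<open>1 - \<delta>\<close>.\<close>

lemma L_sub_close:
  assumes "x \<in> L_sub T K k \<gamma>" "y \<in> L_sub T K k \<gamma>"
  shows "(1 - \<delta>) * x \<le> y"
proof -
  have "2 ^ k * T \<le> x"
    using assms(1) K_pos by (auto simp: L_sub_def intro: order_trans[rotated])
  then have "\<delta> * (2 ^ k * T) \<le> \<delta> * x" using \<delta>_bounds by (intro mult_left_mono) auto
  moreover have "x - y < 2 ^ k * K" using assms by (simp add: L_sub_def algebra_simps)
  ultimately show ?thesis by (simp add: K_eq algebra_simps)
qed

section \<open>Reduced and glued items\<close>

lemma reduced_itemsD:
  assumes "a \<in> I_red"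
  shows "a \<in> I" "\<exists>k\<le>\<kappa>. a \<in> I_lev k"
proof -
  obtain k \<gamma> where a: "a = r k \<gamma>" "k \<le> \<kappa>" "\<gamma> \<in> sub_indices \<kappa>"
      "large_items_sub I p T K k \<gamma> \<noteq> {}"
    using assms by (auto simp: reduced_items_def)
  then have "a \<in> large_items_sub I p T K k \<gamma>"
    using r by (auto simp: reduction_choice_def is_arg_min_def)
  then show "a \<in> I" "\<exists>k\<le>\<kappa>. a \<in> I_lev k"
    using a(2) L_sub_subset_L[OF a(3)] assms
    by (auto simp: large_items_sub_def large_items_def reduced_level_def)
qed

lemma finite_reduced_items: "finite I_red"
proof -
  have "I_red \<subseteq> (\<lambda>(k, \<gamma>). r k \<gamma>) ` ({0..\<kappa>} \<times> sub_indices \<kappa>)"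
    by (auto simp: reduced_items_def)
  then show ?thesis by (rule finite_subset) (simp add: sub_indices_def)
qed

lemma finite_reduced_level: "finite (I_lev k)"
  using finite_reduced_items by (simp add: reduced_level_def)

lemma finite_glued_level: "finite (I_glued k)"
  by (cases k) (auto simp: finite_reduced_level sub_indices_def)

lemma glue_choiceD:
  assumes "k < \<kappa>" "\<gamma> \<in> sub_indices \<kappa>" "cands k \<gamma> \<noteq> {}"
  shows "g (Suc k) \<gamma> \<in> cands k \<gamma>"
    and "b \<in> cands k \<gamma> \<Longrightarrow> ext s (g (Suc k) \<gamma>) \<le> ext s b"
  using g assms by (auto simp: glue_choice_def Let_def is_arg_min_linorder)

lemma reduced_level_items:
  assumes "b \<in> Orig ` I_lev k"
  shows "ext p b \<in> L T k" "0 < ext p b" "0 < ext s b"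
  using assms reduced_itemsD(1) item_pos by (auto simp: reduced_level_def)

text \<open>At a positive level, the profit bound comes from the subinterval for which the item was
  selected, and positivity passes by induction from both parts of a gluing.\<close>

lemma glued_level_items:
  assumes "k \<le> \<kappa>" "b \<in> I_glued k"
  shows "ext p b \<in> L T k" "0 < ext p b" "0 < ext s b"
  using assms
proof (induction k arbitrary: b)
  case 0
  { case 1 then show ?case using reduced_level_items by simp }
  { case 2 then show ?case using reduced_level_items by simp }
  { case 3 then show ?case using reduced_level_items by simp }
next
  case (Suc k)
  have *: "ext p b \<in> L T (Suc k) \<and> 0 < ext p b \<and> 0 < ext s b"
    if le: "Suc k \<le> \<kappa>" and mem: "b \<in> I_glued (Suc k)" for b
  proof -
    obtain \<gamma> where \<gamma>: "\<gamma> \<in> sub_indices \<kappa>" "cands k \<gamma> \<noteq> {}" "b = g (Suc k) \<gamma>"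
      using mem by auto
    then have b: "b \<in> cands k \<gamma>" using glue_choiceD(1) le by simp
    then consider "b \<in> Orig ` I_lev (Suc k)"
      | a a' where "b = a \<oplus> a'" "a \<in> I_glued k" "a' \<in> I_glued k"
      by (auto simp: glue_candidates_def)
    then have "0 < ext p b \<and> 0 < ext s b"
    proof cases
      case 1
      then show ?thesis using reduced_level_items(2,3) by blast
    next
      case 2
      then show ?thesis using Suc.IH(2,3)[of a] Suc.IH(2,3)[of a'] le by simp
    qed
    moreover have "ext p b \<in> L T (Suc k)"
      using b L_sub_subset_L[OF \<gamma>(1)] by (auto simp: glue_candidates_def)
    ultimately show ?thesis by simp
  qed
  { case 1 then show ?case using * by blast }
  { case 2 then show ?case using * by blast }
  { case 3 then show ?case using * by blast }
qed

text \<open>\<open>b\<close> competes in the subinterval that contains its profit, so the item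
  selected there is no larger and has a profit in the same subinterval. The two alternatives serve
  itemwise replacement and pairing.\<close>

lemma rounding:
  assumes "k < \<kappa>" "ext p b \<in> L T (Suc k)"
    and "b \<in> Orig ` I_lev (Suc k) \<or>
      (\<exists>a a'. b = a \<oplus> a' \<and> a \<in> I_glued k \<and> a' \<in> I_glued k \<and> ext s a + ext s a' \<le> capacity)"
  shows "\<exists>b'\<in>I_glued (Suc k). ext s b' \<le> ext s b \<and> (1 - \<delta>) * ext p b \<le> ext p b'"
proof -
  obtain \<gamma> where \<gamma>: "\<gamma> \<in> sub_indices \<kappa>" "ext p b \<in> L_sub T K (Suc k) \<gamma>"
    using L_sub_cover[OF assms(2)] .
  then have b: "b \<in> cands k \<gamma>" using assms(3) by (auto simp: glue_candidates_def)
  then have ne: "cands k \<gamma> \<noteq> {}" by blast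
  have "(1 - \<delta>) * ext p b \<le> ext p (g (Suc k) \<gamma>)"
    using glue_choiceD(1)[OF assms(1) \<gamma>(1) ne] \<gamma>(2) L_sub_close
    by (auto simp: glue_candidates_def)
  moreover have "g (Suc k) \<gamma> \<in> I_glued (Suc k)" using \<gamma>(1) ne by auto
  ultimately show ?thesis using glue_choiceD(2)[OF assms(1) \<gamma>(1) ne b] by blast
qed

section \<open>Item sets with the lower levels glued\<close>

text \<open>The intermediate item sets of the induction over the levels. For \<open>j = 0\<close>
  the pool consists of the reduced items, for \<open>j = k\<^sub>0 + 1\<close> it is the item set of
  the theorem.\<close>

definition item_pool :: "nat \<Rightarrow> 'a glued set" where
  "item_pool j = (\<Union>k\<in>{0..j}. I_glued k) \<union> (\<Union>k\<in>{j + 1..\<kappa>}. Orig ` I_lev k)"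

lemma finite_item_pool: "finite (item_pool j)"
  by (simp add: item_pool_def finite_glued_level finite_reduced_level)

lemma item_pool_cases:
  assumes "b \<in> item_pool j"
  obtains (glued) k where "k \<le> j" "b \<in> I_glued k"
    | (orig) k where "j < k" "k \<le> \<kappa>" "b \<in> Orig ` I_lev k"
proof -
  from assms have "(\<exists>k\<in>{0..j}. b \<in> I_glued k) \<or> (\<exists>k\<in>{j + 1..\<kappa>}. b \<in> Orig ` I_lev k)"
    unfolding item_pool_def Un_iff UN_iff .
  then show thesis
  proof (elim disjE bexE)
    fix k assume "k \<in> {0..j}" "b \<in> I_glued k"
    then show thesis using glued[of k] by simp
  next
    fix k assume "k \<in> {j + 1..\<kappa>}" "b \<in> Orig ` I_lev k"
    then show thesis using orig[of k] by simp
  qed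
qed

lemma item_pool_pos:
  assumes "j \<le> \<kappa>" "b \<in> item_pool j"
  shows "0 < ext p b" "0 < ext s b"
proof -
  from assms(2) have "0 < ext p b \<and> 0 < ext s b"
  proof (cases rule: item_pool_cases)
    case (glued k)
    then show ?thesis using glued_level_items(2,3)[of k b] assms(1) by simp
  next
    case (orig k)
    then show ?thesis using reduced_level_items(2,3)[of b k] by simp
  qed
  then show "0 < ext p b" "0 < ext s b" by auto
qed

text \<open>The intervals are disjoint, so the profit of an item tells which part of the union it
  comes from.\<close>

lemma item_pool_level:
  assumes "j \<le> \<kappa>" "b \<in> item_pool j" "ext p b \<in> L T k"
  shows "k \<le> j \<Longrightarrow> b \<in> I_glued k" "j < k \<Longrightarrow> b \<in> Orig ` I_lev k"
proof -
  from assms(2) have *: "(k \<le> j \<and> b \<in> I_glued k) \<or> (j < k \<and> b \<in> Orig ` I_lev k)"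
  proof (cases rule: item_pool_cases)
    case (glued l)
    from glued assms(1) have "l \<le> \<kappa>" by (blast intro: order_trans)
    then have "l = k"
      by (rule L_disjoint[OF T_pos glued_level_items(1)[OF _ glued(2)] assms(3)])
    then show ?thesis using glued by blast
  next
    case (orig l)
    have "l = k" by (rule L_disjoint[OF T_pos reduced_level_items(1)[OF orig(3)] assms(3)])
    then show ?thesis using orig by blast
  qed
  { assume "k \<le> j" with * show "b \<in> I_glued k" by linarith }
  { assume "j < k" with * show "b \<in> Orig ` I_lev k" by linarith }
qed

text \<open>The passage to the next pool replaces items of level \<open>Suc j\<close> only.\<close>

lemma item_pool_Suc:
  assumes "b \<in> item_pool j" "ext p b \<notin> L T (Suc j)"
  shows "b \<in> item_pool (Suc j)"
  using assms(1)
proof (cases rule: item_pool_cases)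
  case (glued l)
  then have "l \<in> {0..Suc j}" by simp
  then show ?thesis using glued(2) unfolding item_pool_def by blast
next
  case (orig l)
  then have "l \<noteq> Suc j" using reduced_level_items(1)[OF orig(3)] assms(2) by blast
  then have "l \<in> {Suc j + 1..\<kappa>}" using orig by simp
  then show ?thesis using orig(3) unfolding item_pool_def by blast
qed

section \<open>Treating one level after the other\<close>

text \<open>\<open>j\<close> is the number of levels already treated, hence the strict bound:
  nothing is demanded for \<open>j = 0\<close>, and \<open>j = k\<^sub>0 + 1\<close> matches
  \<open>struct_opt_values\<close> with \<open>k\<^sub>0\<close>.\<close>

definition structured :: "nat \<Rightarrow> real \<Rightarrow> 'a glued multiset \<Rightarrow> bool" where
  "structured j v M \<longleftrightarrow> set_mset M \<subseteq> item_pool j \<and> (\<Sum>b\<in>#M. ext s b) \<le> v \<and>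
     (\<forall>k<j. size (filter_mset (\<lambda>b. ext p b \<in> L T k) M) \<le> 1)"

lemma structured_step:
  assumes "structured j v M" "v \<le> capacity" "j < \<kappa>"
  obtains M' where "structured (Suc j) v M'"
    "(1 - \<delta>) * (\<Sum>b\<in>#M. ext p b) \<le> (\<Sum>b\<in>#M'. ext p b)"
proof -
  \<comment> \<open>\<open>A\<close> is to be paired, \<open>B\<close> is to be rounded item by
    item, and \<open>C\<close> stays as it is.\<close>
  define A where "A = filter_mset (\<lambda>b. ext p b \<in> L T j) M"
  define D where "D = filter_mset (\<lambda>b. ext p b \<notin> L T j) M"
  define B where "B = filter_mset (\<lambda>b. ext p b \<in> L T (Suc j)) D"
  define C where "C = filter_mset (\<lambda>b. ext p b \<notin> L T (Suc j)) D"
  have "M = A + D" unfolding A_def D_def by (rule multiset_partition)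
  moreover have "D = B + C" unfolding B_def C_def by (rule multiset_partition)
  ultimately have M: "M = A + (B + C)" by simp
  have pool: "set_mset M \<subseteq> item_pool j" and size: "(\<Sum>b\<in>#M. ext s b) \<le> v"
    and few: "\<And>k. k < j \<Longrightarrow> size (filter_mset (\<lambda>b. ext p b \<in> L T k) M) \<le> 1"
    using assms(1) by (auto simp: structured_def)
  have j: "j \<le> \<kappa>" "Suc j \<le> \<kappa>" using assms(3) by auto
  have nonneg: "0 \<le> (\<Sum>b\<in>#B. ext s b)" "0 \<le> (\<Sum>b\<in>#C. ext s b)" "0 \<le> (\<Sum>b\<in>#C. ext p b)"
    using pool M item_pool_pos[OF j(1)]
    by (auto intro!: sum_mset_image_nonneg simp: less_imp_le subset_iff)

  have "set_mset A \<subseteq> I_glued j"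
    using pool item_pool_level(1)[OF j(1)] by (auto simp: A_def)
  \<comment> \<open>The bound on \<open>v\<close> enters here: gluings are formed only within the
    capacity.\<close>
  moreover have "(\<Sum>b\<in>#A. ext s b) \<le> capacity" using size nonneg assms(2) M by simp
  moreover have "\<exists>b\<in>I_glued (Suc j). ext s b \<le> ext s a + ext s a' \<and>
      (1 - \<delta>) * (ext p a + ext p a') \<le> ext p b"
    if "a \<in> I_glued j" "a' \<in> I_glued j" "ext s a + ext s a' \<le> capacity" for a a'
    using rounding[OF assms(3), of "a \<oplus> a'"] that glued_level_items(1)[OF j(1)] add_in_L_Suc
    by auto
  ultimately obtain R A' where RA:
    "set_mset R \<subseteq> I_glued j" "size R \<le> 1" "set_mset A' \<subseteq> I_glued (Suc j)"
    "(\<Sum>a\<in>#R + A'. ext s a) \<le> (\<Sum>a\<in>#A. ext s a)"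
    "(1 - \<delta>) * (\<Sum>a\<in>#A. ext p a) \<le> (\<Sum>a\<in>#R + A'. ext p a)"
    using pairing[of "I_glued j" "ext s" capacity "I_glued (Suc j)" "1 - \<delta>" "ext p" A]
      glued_level_items(2,3)[OF j(1)] \<delta>_bounds by (auto simp: less_imp_le)

  \<comment> \<open>Level \<open>Suc j\<close> of the pool still consists of original items, which
    compete with the gluings.\<close>
  have "b \<in> Orig ` I_lev (Suc j) \<and> ext p b \<in> L T (Suc j)" if "b \<in># B" for b
    using that pool item_pool_level(2)[OF j(1)] by (auto simp: B_def D_def)
  then obtain B' where B':
    "set_mset B' \<subseteq> I_glued (Suc j)" "(\<Sum>a\<in>#B'. ext s a) \<le> (\<Sum>a\<in>#B. ext s a)"
    "(1 - \<delta>) * (\<Sum>a\<in>#B. ext p a) \<le> (\<Sum>a\<in>#B'. ext p a)"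
    using itemwise_replacement[of B "I_glued (Suc j)" "ext s" "1 - \<delta>" "ext p"]
      rounding[OF assms(3)] by meson

  define M' where "M' = R + A' + B' + C"
  \<comment> \<open>The replacements all lie in level \<open>Suc j\<close>, where
    \<open>structured (Suc j)\<close> sets no bound on their number.\<close>
  have new: "ext p b \<in> L T (Suc j)" if "b \<in># A' + B'" for b
    using that RA(3) B'(1) glued_level_items(1)[OF j(2)] unfolding set_mset_union by blast
  have R: "ext p b \<in> L T j" if "b \<in># R" for b
    using that RA(1) glued_level_items(1)[OF j(1)] by auto
  have "set_mset M' \<subseteq> item_pool (Suc j)"
  proof -
    have "set_mset C \<subseteq> item_pool (Suc j)"
      using pool item_pool_Suc by (auto simp: C_def D_def)
    moreover have "I_glued j \<subseteq> item_pool (Suc j)" "I_glued (Suc j) \<subseteq> item_pool (Suc j)"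
      unfolding item_pool_def by fastforce+
    ultimately show ?thesis using RA(1,3) B'(1) unfolding M'_def by auto
  qed
  moreover have "(\<Sum>b\<in>#M'. ext s b) \<le> v" using RA(4) B'(2) size M by (simp add: M'_def)
  moreover have "size (filter_mset (\<lambda>b. ext p b \<in> L T k) M') \<le> 1" if "k < Suc j" for k
  proof (cases "k = j")
    case True
    \<comment> \<open>At level \<open>j\<close> only \<open>R\<close> is left: \<open>C\<close> has
      no items there and the new items are one level higher.\<close>
    have "size (filter_mset (\<lambda>b. ext p b \<in> L T k) (A' + B')) = 0"
      using new True L_disjoint[OF T_pos] unfolding size_eq_0_iff_empty filter_mset_eq_mempty_iff
      by (metis n_not_Suc_n)
    moreover have "size (filter_mset (\<lambda>b. ext p b \<in> L T k) C) = 0"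
      using True by (auto simp: C_def D_def)
    moreover have "size (filter_mset (\<lambda>b. ext p b \<in> L T k) R) \<le> 1"
      using RA(2) size_filter_mset_lesseq[of _ R] order_trans by blast
    ultimately show ?thesis unfolding M'_def filter_union_mset size_union by linarith
  next
    case False
    \<comment> \<open>Below level \<open>j\<close> only \<open>C\<close> contributes, and it is a
      part of \<open>M\<close>.\<close>
    have "size (filter_mset (\<lambda>b. ext p b \<in> L T k) (A' + B')) = 0"
      using new that L_disjoint[OF T_pos] unfolding size_eq_0_iff_empty filter_mset_eq_mempty_iff
      by (metis less_irrefl)
    moreover have "size (filter_mset (\<lambda>b. ext p b \<in> L T k) R) = 0"
      using R False L_disjoint[OF T_pos] unfolding size_eq_0_iff_empty filter_mset_eq_mempty_iff
      by metis
    moreover have "size (filter_mset (\<lambda>b. ext p b \<in> L T k) C) \<le> 1"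
      using few[of k] False that M by simp
    ultimately show ?thesis unfolding M'_def filter_union_mset size_union by linarith
  qed
  ultimately have "structured (Suc j) v M'" by (simp add: structured_def)
  \<comment> \<open>\<open>C\<close> is unchanged; its nonnegative profit is weakened only to share
    the common factor.\<close>
  moreover have "(1 - \<delta>) * (\<Sum>b\<in>#C. ext p b) \<le> (\<Sum>b\<in>#C. ext p b)"
    using mult_right_mono[of "1 - \<delta>" 1] nonneg(3) \<delta>_bounds by simp
  then have "(1 - \<delta>) * (\<Sum>b\<in>#M. ext p b) \<le> (\<Sum>b\<in>#M'. ext p b)"
    using RA(5) B'(3) by (simp add: M M'_def distrib_left)
  ultimately show thesis by (rule that)
qed

text \<open>Iterates \<open>structured_step\<close>; each treated level contributes one factor
  \<open>1 - \<delta>\<close>.\<close>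

lemma structured_exists:
  assumes "set_mset M \<subseteq> Orig ` I_red" "(\<Sum>b\<in>#M. ext s b) \<le> v" "v \<le> capacity" "j \<le> \<kappa>"
  shows "\<exists>M'. structured j v M' \<and> (1 - \<delta>) ^ j * (\<Sum>b\<in>#M. ext p b) \<le> (\<Sum>b\<in>#M'. ext p b)"
  using assms(4)
proof (induction j)
  case 0
  have "Orig a \<in> item_pool 0" if a: "a \<in> I_red" for a
  proof -
    obtain k where "k \<le> \<kappa>" "a \<in> I_lev k" using reduced_itemsD(2)[OF a] by blast
    then show ?thesis by (cases k) (fastforce simp: item_pool_def)+
  qed
  then have "structured 0 v M" using assms(1,2) by (auto simp: structured_def)
  then show ?case by auto
next
  case (Suc j)
  then obtain M1 where M1: "structured j v M1"
      "(1 - \<delta>) ^ j * (\<Sum>b\<in>#M. ext p b) \<le> (\<Sum>b\<in>#M1. ext p b)"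
    by auto
  moreover from Suc.prems have "j < \<kappa>" by simp
  ultimately obtain M2 where M2: "structured (Suc j) v M2"
      "(1 - \<delta>) * (\<Sum>b\<in>#M1. ext p b) \<le> (\<Sum>b\<in>#M2. ext p b)"
    using structured_step assms(3) by blast
  have "(1 - \<delta>) * ((1 - \<delta>) ^ j * (\<Sum>b\<in>#M. ext p b)) \<le> (1 - \<delta>) * (\<Sum>b\<in>#M1. ext p b)"
    using M1(2) \<delta>_bounds by (intro mult_left_mono) auto
  with M2 show ?case by (intro exI[of _ M2]) (simp add: mult.assoc)
qed

section \<open>From the optimum to the structured optimum\<close>

text \<open>The maximum is attained by a vector of multiplicities, which is read as the multiset
  with \<open>x a\<close> copies of each \<open>Orig a\<close>.\<close>

lemma opt_attained:
  assumes "0 \<le> v"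
  obtains M where "set_mset M \<subseteq> Orig ` I_red" "(\<Sum>b\<in>#M. ext s b) \<le> v"
    "(\<Sum>b\<in>#M. ext p b) = opt p s I_red v"
proof -
  have "opt p s I_red v \<in> opt_values p s I_red v"
    unfolding opt_def using finite_reduced_items reduced_itemsD(1) item_pos assms
    by (intro Max_in opt_values_finite_nonempty[where A = I_red and v = v]) blast+
  then obtain x where x: "opt p s I_red v = (\<Sum>a\<in>I_red. p a * real (x a))"
      "(\<Sum>a\<in>I_red. s a * real (x a)) \<le> v"
    by (auto simp: opt_values_def)
  define M where "M = (\<Sum>a\<in>I_red. replicate_mset (x a) (Orig a))"
  have sum: "(\<Sum>b\<in>#(\<Sum>a\<in>A. replicate_mset (x a) (Orig a)). ext f b) =
      (\<Sum>a\<in>A. f a * real (x a))" if "finite A" for f A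
    using that by (induction A) (auto simp: mult.commute)
  have "set_mset M \<subseteq> Orig ` I_red"
    using finite_reduced_items by (auto simp: M_def set_mset_sum split: if_splits)
  then show thesis
    using x by (intro that[of M]) (simp_all add: M_def sum finite_reduced_items)
qed

text \<open>Treating the levels 0 to \<open>k\<close> takes \<open>k + 1\<close> steps. The profit
  of the resulting multiset is at most the maximum since the set of values is finite.\<close>

lemma struct_opt_ge:
  assumes "0 \<le> v" "v \<le> capacity" "k < \<kappa>"
  shows "(1 - \<delta>) ^ (k + 1) * opt p s I_red v
    \<le> struct_opt (ext p) (ext s) T k (item_pool (k + 1)) v"
proof -
  obtain M where M: "set_mset M \<subseteq> Orig ` I_red" "(\<Sum>b\<in>#M. ext s b) \<le> v"
      "(\<Sum>b\<in>#M. ext p b) = opt p s I_red v"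
    using opt_attained[OF assms(1)] .
  then obtain M' where M': "structured (k + 1) v M'"
      "(1 - \<delta>) ^ (k + 1) * opt p s I_red v \<le> (\<Sum>b\<in>#M'. ext p b)"
    using structured_exists[of M v "k + 1"] assms by auto
  have "(\<Sum>b\<in>#M'. ext p b) \<in> struct_opt_values (ext p) (ext s) T k (item_pool (k + 1)) v"
    using M'(1) by (auto simp: struct_opt_values_def structured_def)
  moreover have "finite (struct_opt_values (ext p) (ext s) T k (item_pool (k + 1)) v)"
    using finite_item_pool item_pool_pos(2)[of "k + 1"] assms
    by (intro struct_opt_values_finite_nonempty) auto
  ultimately have "(\<Sum>b\<in>#M'. ext p b) \<le> struct_opt (ext p) (ext s) T k (item_pool (k + 1)) v"
    unfolding struct_opt_def by (intro Max_ge)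
  with M'(2) show ?thesis by simp
qed

end

section \<open>The constants of the instance\<close>

theorem theorem5:
  fixes I :: "'a set"
    and p s :: "'a \<Rightarrow> real"
    and \<kappa> k\<^sub>0 :: nat
    and \<epsilon> P\<^sub>0 T K v :: real
    and a\<^sub>m\<^sub>e :: 'a
    and r :: "nat \<Rightarrow> nat \<Rightarrow> 'a"
    and g :: "nat \<Rightarrow> nat \<Rightarrow> 'a glued"
  assumes "ukp_instance I p s"
    and "\<epsilon> = 1 / 2 powi (int \<kappa> - 1)" and "\<epsilon> \<le> 1 / 4"
    and "is_arg_max (\<lambda>a. p a / s a) (\<lambda>a. a \<in> I) a\<^sub>m\<^sub>e"
    and "P\<^sub>0 = p a\<^sub>m\<^sub>e * real_of_int \<lfloor>capacity / s a\<^sub>m\<^sub>e\<rfloor>"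
    and "T = 1 / 2 * \<epsilon> * P\<^sub>0"
    and "K = 1 / 4 * (1 / (real \<kappa> + 1)) * \<epsilon> * T"
    and "\<forall>a\<in>I. p a \<noteq> 2 * P\<^sub>0"
    and "reduction_choice I p s T K \<kappa> r"
    and "glue_choice I p s T K \<kappa> r g"
    and "0 \<le> v" and "v \<le> capacity"
    and "k\<^sub>0 < \<kappa>"
  shows "struct_opt (ext p) (ext s) T k\<^sub>0
           ((\<Union>k\<in>{0..k\<^sub>0 + 1}. glued_level I p s T K \<kappa> r g k) \<union>
            (\<Union>k\<in>{k\<^sub>0 + 2..\<kappa>}. Orig ` reduced_level I p T K \<kappa> r k)) v
         \<ge> (1 - \<epsilon> / 4 * (1 / (log 2 (2 / \<epsilon>) + 1))) ^ (k\<^sub>0 + 1)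
           * opt p s (reduced_items I p T K \<kappa> r) v"
proof -
  \<comment> \<open>Since \<epsilon> is \<open>2 / 2 ^ \<kappa>\<close>, the logarithm in the claim
    is just \<kappa>, and \<delta> below is the loss per level.\<close>
  have \<epsilon>: "0 < \<epsilon>" "\<epsilon> * 2 ^ \<kappa> = 2"
    using assms(2) by (simp_all add: power_int_diff)
  have "2 / \<epsilon> = 2 ^ \<kappa>" using \<epsilon> by (simp add: field_simps)
  then have log: "log 2 (2 / \<epsilon>) = real \<kappa>" by (simp add: log_nat_power)
  define \<delta> where "\<delta> = \<epsilon> / 4 * (1 / (real \<kappa> + 1))"
  have a: "0 < p a\<^sub>m\<^sub>e" "0 < s a\<^sub>m\<^sub>e" "s a\<^sub>m\<^sub>e \<le> 1"
    using assms(1,4) by (auto simp: ukp_instance_def is_arg_max_def)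
  \<comment> \<open>The quotient is at least 1 because the size of the item is at most the capacity,
    so its floor is positive.\<close>
  then have "0 < real_of_int \<lfloor>capacity / s a\<^sub>m\<^sub>e\<rfloor>" by simp
  then have "0 < P\<^sub>0" unfolding assms(5) using a(1) by (rule mult_pos_pos[rotated])
  then have "0 < T" unfolding assms(6) using \<epsilon>(1) by simp
  moreover have "0 < \<delta>" using \<epsilon>(1) by (simp add: \<delta>_def)
  moreover have "\<delta> \<le> 1"
  proof -
    have "\<epsilon> / 4 * (1 / (real \<kappa> + 1)) \<le> 1 * 1"
      using \<epsilon>(1) assms(3) by (intro mult_mono) auto
    then show ?thesis by (simp add: \<delta>_def)
  qed
  moreover have "K = \<delta> * T" using assms(7) by (simp add: \<delta>_def)
  \<comment> \<open>The factor \<open>\<kappa> + 1\<close> cancels against the one in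
    \<open>K\<close>; what remains is \<open>\<epsilon> * 2 ^ \<kappa> / 2 = 1\<close> times
    \<open>T\<close>.\<close>
  moreover have "2 ^ (\<kappa> + 1) * (real \<kappa> + 1) * K = T"
  proof -
    have "(real \<kappa> + 1) * K = \<epsilon> * T / 4"
      unfolding assms(7) by (simp add: field_simps)
    then have "2 ^ (\<kappa> + 1) * (real \<kappa> + 1) * K = (\<epsilon> * 2 ^ \<kappa>) / 2 * T"
      by simp
    then show ?thesis using \<epsilon>(2) by simp
  qed
  ultimately interpret gluing I p s T K \<delta> \<kappa> r g
    using assms(1,9,10) by unfold_locales (auto simp: ukp_instance_def)
  show ?thesis
    using struct_opt_ge[OF assms(11-13)] by (simp add: item_pool_def \<delta>_def log)
qed

end
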